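(* Let $p$ be a prime and let $G=(\mathbb Z_p,+)$. Suppose that the multiplicative group $(\mathbb Z_p\setminus\{0\},\cdot)$ is generated by $2$. Then the multiplicative subgroup $\langle 2^2\rangle\subseteq\mathbb Z_p\setminus\{0\}$, regarded as a subset of $G$, is a quasi-signature set in $G$ for a $(p+1,k)$-equiangular frame (for some $k$) if and only if $p\equiv 5\pmod 8$. In this case $k=\frac{p+1}{2}$.
   Context: An $(n,k)$-frame is a Parseval frame $\{f_1,\dots,f_n\}$ for $\mathbb C^k$, i.e. $\sum_{j}|\langle x,f_j\rangle|^2=\|x\|^2$ for all $x\in\mathbb C^k$. It is equiangular if all $f_i\neq 0$ and there is a constant $b$ with $|\langle f_i/\|f_i\|,f_j/\|f_j\|\rangle|=b$ for all $i\ne j$. For $1\le k<n$, put $c_{n,k}=\sqrt{\frac{k(n-k)}{n^2(n-1)}}$. A self-adjoint $n\times n$ matrix $Q$ with $Q_{ii}=0$ and $|Q_{ij}|=1$ for $i\neq j$ is the signature matrix of an $(n,k)$-equiangular frame if there is an equiangular $(n,k)$-frame whose Gram matrix $(\langle f_j,f_i\rangle)_{i,j}$ equals $\frac kn I_n+c_{n,k}Q$. Throughout $1\le k<n$. Let $G$ be a finite group of order $m$ with identity $e$ and left regular representation $\lambda$ (here for $G=(\mathbb Z_p,+)$: $m=p$, $e=0$, $\lambda(g)e_h=e_{g+h}$), regarded as $m\times m$ permutation matrices. For $S\subseteq G\setminus\{e\}$ and $T=(G\setminus\{e\})\setminus S$, let $Q=\sum_{g\in S}\lambda(g)-\sum_{h\in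 T}\lambda(h)$ and let $\tilde Q=\begin{bmatrix}0&C^t\\ C&Q\end{bmatrix}$, where $C\in\mathbb C^m$ is the all-ones column vector. With $n=m+1$, $S$ is a quasi-signature set in $G$ for an $(n,k)$-equiangular frame if the $n\times n$ matrix $\tilde Q$ is the signature matrix of an $(n,k)$-equiangular frame. *)

theory Defs
  imports
    "Jordan_Normal_Form.Schur_Decomposition"
    "HOL-Algebra.Multiplicative_Group"
    "HOL-Algebra.Generated_Groups"
    "HOL-Number_Theory.Residues"
begin

text \<open>
  Vectors in \<open>\<complex>\<^sup>k\<close> are elements of \<^term>\<open>carrier_vec k\<close>; the inner product
  \<open>\<langle>x, y\<rangle>\<close> is \<^term>\<open>x \<bullet>c y\<close>, linear in its first argument. A family \<open>f\<^sub>1, \<dots>, f\<^sub>n\<close>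
  is a function \<open>f\<close> whose values at \<open>0, \<dots>, n - 1\<close> are the members of the family.
\<close>

definition cvec_norm :: "complex vec \<Rightarrow> real" where
  "cvec_norm x = sqrt (Re (x \<bullet>c x))"

definition nk_frame :: "nat \<Rightarrow> nat \<Rightarrow> (nat \<Rightarrow> complex vec) \<Rightarrow> bool" where
  "nk_frame n k f \<longleftrightarrow>
     1 \<le> k \<and> k < n \<and> (\<forall>j<n. f j \<in> carrier_vec k) \<and>
     (\<forall>x\<in>carrier_vec k. (\<Sum>j<n. (cmod (x \<bullet>c f j))\<^sup>2) = (cvec_norm x)\<^sup>2)"

definition normalized_vec :: "complex vec \<Rightarrow> complex vec" where
  "normalized_vec x = complex_of_real (1 / cvec_norm x) \<cdot>\<^sub>v x"

definition equiangular_frame :: "nat \<Rightarrow> nat \<Rightarrow> (nat \<Rightarrow> complex vec) \<Rightarrow> bool" where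
  "equiangular_frame n k f \<longleftrightarrow>
     nk_frame n k f \<and> (\<forall>i<n. f i \<noteq> 0\<^sub>v k) \<and>
     (\<exists>b::real. \<forall>i<n. \<forall>j<n. i \<noteq> j \<longrightarrow> cmod (normalized_vec (f i) \<bullet>c normalized_vec (f j)) = b)"

definition gram_matrix :: "nat \<Rightarrow> (nat \<Rightarrow> complex vec) \<Rightarrow> complex mat" where
  "gram_matrix n f = mat n n (\<lambda>(i, j). f j \<bullet>c f i)"

definition frame_const :: "nat \<Rightarrow> nat \<Rightarrow> real" where
  "frame_const n k = sqrt (real k * (real n - real k) / ((real n)\<^sup>2 * (real n - 1)))"

definition is_signature_matrix :: "nat \<Rightarrow> nat \<Rightarrow> complex mat \<Rightarrow> bool" where
  "is_signature_matrix n k Q \<longleftrightarrow>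
     Q \<in> carrier_mat n n \<and> mat_adjoint Q = Q \<and>
     (\<forall>i<n. Q $$ (i, i) = 0) \<and>
     (\<forall>i<n. \<forall>j<n. i \<noteq> j \<longrightarrow> cmod (Q $$ (i, j)) = 1) \<and>
     (\<exists>f. equiangular_frame n k f \<and>
          gram_matrix n f =
            complex_of_real (real k / real n) \<cdot>\<^sub>m 1\<^sub>m n + complex_of_real (frame_const n k) \<cdot>\<^sub>m Q)"

text \<open>
  Matrices are indexed by natural numbers, so writing \<open>\<lambda>(g)\<close> as an \<open>m \<times> m\<close> matrix
  requires an enumeration \<open>enum\<close> of the group elements: index \<open>i\<close> stands for the basis
  vector \<open>e\<^sub>h\<close> with \<open>h = enum i\<close>.
\<close>

definition group_enum :: "('g, 'b) monoid_scheme \<Rightarrow> (nat \<Rightarrow> 'g) \<Rightarrow> bool" where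
  "group_enum G enum \<longleftrightarrow> bij_betw enum {..<Coset.order G} (carrier G)"

text \<open>Column \<open>j\<close> has its single entry 1 in the row of \<open>g \<otimes> enum j\<close>.\<close>

definition left_regular :: "('g, 'b) monoid_scheme \<Rightarrow> (nat \<Rightarrow> 'g) \<Rightarrow> 'g \<Rightarrow> complex mat" where
  "left_regular G enum g =
     mat (Coset.order G) (Coset.order G) (\<lambda>(i, j). if enum i = g \<otimes>\<^bsub>G\<^esub> enum j then 1 else 0)"

definition mat_sum :: "nat \<Rightarrow> ('g \<Rightarrow> complex mat) \<Rightarrow> 'g set \<Rightarrow> complex mat" where
  "mat_sum m A S = finsum (module_mat TYPE(complex) m m) A S"

definition group_signature :: "('g, 'b) monoid_scheme \<Rightarrow> (nat \<Rightarrow> 'g) \<Rightarrow> 'g set \<Rightarrow> complex mat" where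
  "group_signature G enum S =
     mat_sum (Coset.order G) (left_regular G enum) S -
     mat_sum (Coset.order G) (left_regular G enum) ((carrier G - {\<one>\<^bsub>G\<^esub>}) - S)"

definition bordered_mat :: "nat \<Rightarrow> complex mat \<Rightarrow> complex mat" where
  "bordered_mat m Q =
     (let C = mat m 1 (\<lambda>_. 1) in four_block_mat (0\<^sub>m 1 1) (transpose_mat C) C Q)"

text \<open>
  The choice of enumeration is immaterial: see \<open>quasi_signature_set_iff\<close> below.
\<close>

definition quasi_signature_set ::
  "('g, 'b) monoid_scheme \<Rightarrow> nat \<Rightarrow> nat \<Rightarrow> 'g set \<Rightarrow> bool" where
  "quasi_signature_set G n k S \<longleftrightarrow>
     group G \<and> finite (carrier G) \<and> n = Coset.order G + 1 \<and> S \<subseteq> carrier G - {\<one>\<^bsub>G\<^esub>} \<and>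
     (\<exists>enum. group_enum G enum \<and>
             is_signature_matrix n k (bordered_mat (Coset.order G) (group_signature G enum S)))"

lemma mat_sum_carrier:
  assumes "\<And>g. g \<in> S \<Longrightarrow> A g \<in> carrier_mat m m"
  shows "mat_sum m A S \<in> carrier_mat m m"
proof -
  interpret abelian_group "module_mat TYPE(complex) m m" by (rule abelian_group_mat)
  show ?thesis
    using finsum_closed[of A S] assms by (auto simp: mat_sum_def module_mat_simps)
qed

lemma index_mat_sum:
  assumes "finite S" "\<And>g. g \<in> S \<Longrightarrow> A g \<in> carrier_mat m m" "i < m" "j < m"
  shows "mat_sum m A S $$ (i, j) = (\<Sum>g\<in>S. A g $$ (i, j))"
  using assms(1,2)
proof (induction S rule: finite_induct)
  case empty
  interpret abelian_group "module_mat TYPE(complex) m m" by (rule abelian_group_mat)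
  show ?case using assms(3,4) by (simp add: mat_sum_def module_mat_simps)
next
  case (insert x F)
  interpret abelian_group "module_mat TYPE(complex) m m" by (rule abelian_group_mat)
  have "mat_sum m A (insert x F) = A x + mat_sum m A F"
    unfolding mat_sum_def
    by (subst finsum_insert) (use insert in \<open>auto simp: module_mat_simps\<close>)
  moreover have "mat_sum m A F \<in> carrier_mat m m"
    by (rule mat_sum_carrier) (use insert in auto)
  ultimately show ?case
    using insert assms(3,4) by auto
qed

lemma left_regular_carrier [simp]: "left_regular G enum g \<in> carrier_mat (Coset.order G) (Coset.order G)"
  by (simp add: left_regular_def)

lemma group_signature_carrier: "group_signature G enum S \<in> carrier_mat (Coset.order G) (Coset.order G)"
  unfolding group_signature_def by (rule minus_carrier_mat) (simp add: mat_sum_carrier)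

lemma index_group_signature:
  assumes "finite (carrier G)" "S \<subseteq> carrier G" "i < Coset.order G" "j < Coset.order G"
  shows "group_signature G enum S $$ (i, j) =
    (\<Sum>g\<in>S. if enum i = g \<otimes>\<^bsub>G\<^esub> enum j then 1 else 0) -
    (\<Sum>g\<in>(carrier G - {\<one>\<^bsub>G\<^esub>}) - S. if enum i = g \<otimes>\<^bsub>G\<^esub> enum j then 1 else 0)"
proof -
  have fin: "finite S" "finite ((carrier G - {\<one>\<^bsub>G\<^esub>}) - S)"
    using assms finite_subset by auto
  have "mat_sum (Coset.order G) (left_regular G enum) X \<in> carrier_mat (Coset.order G) (Coset.order G)" for X
    by (rule mat_sum_carrier) simp
  then have "group_signature G enum S $$ (i, j) =
      mat_sum (Coset.order G) (left_regular G enum) S $$ (i, j) -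
      mat_sum (Coset.order G) (left_regular G enum) ((carrier G - {\<one>\<^bsub>G\<^esub>}) - S) $$ (i, j)"
    unfolding group_signature_def using assms(3,4) by (metis carrier_matD index_minus_mat(1))
  then show ?thesis
    using assms(3,4) fin by (simp add: index_mat_sum left_regular_def)
qed

lemma bordered_mat_carrier:
  "Q \<in> carrier_mat m m \<Longrightarrow> bordered_mat m Q \<in> carrier_mat (m + 1) (m + 1)"
  unfolding bordered_mat_def Let_def by auto

lemma index_bordered_mat:
  assumes "Q \<in> carrier_mat m m" "i < m + 1" "j < m + 1"
  shows "bordered_mat m Q $$ (i, j) =
    (if i = 0 then (if j = 0 then 0 else 1) else if j = 0 then 1 else Q $$ (i - 1, j - 1))"
  using assms unfolding bordered_mat_def Let_def by auto

lemma mat_adjoint_eq_iff: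
  assumes "Q \<in> carrier_mat n n"
  shows "mat_adjoint Q = Q \<longleftrightarrow> (\<forall>i<n. \<forall>j<n. Q $$ (i, j) = cnj (Q $$ (j, i)))"
proof -
  have "mat_adjoint Q \<in> carrier_mat n n"
    using assms by (auto simp: mat_adjoint_def)
  moreover have "mat_adjoint Q $$ (i, j) = cnj (Q $$ (j, i))" if "i < n" "j < n" for i j
    using assms that by (auto simp: mat_adjoint_def mat_of_rows_index)
  ultimately show ?thesis
    using assms by (metis carrier_matD eq_matI)
qed

lemma is_signature_matrix_permute:
  assumes Q: "is_signature_matrix n k Q" and \<sigma>: "bij_betw \<sigma> {..<n} {..<n}"
  shows "is_signature_matrix n k (mat n n (\<lambda>(i, j). Q $$ (\<sigma> i, \<sigma> j)))"
proof -
  have lt: "\<sigma> i < n" if "i < n" for i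
    using \<sigma> that by (auto dest: bij_betwE)
  have ne: "\<sigma> i \<noteq> \<sigma> j" if "i < n" "j < n" "i \<noteq> j" for i j
    using \<sigma> that by (auto simp: bij_betw_def inj_on_def)
  from Q have Qc: "Q \<in> carrier_mat n n" by (simp add: is_signature_matrix_def)
  from Q obtain f where f: "equiangular_frame n k f"
    and gram: "gram_matrix n f =
      complex_of_real (real k / real n) \<cdot>\<^sub>m 1\<^sub>m n + complex_of_real (frame_const n k) \<cdot>\<^sub>m Q"
    by (auto simp: is_signature_matrix_def)
  have sum_eq: "(\<Sum>j<n. (cmod (x \<bullet>c f (\<sigma> j)))\<^sup>2) = (\<Sum>j<n. (cmod (x \<bullet>c f j))\<^sup>2)" for x
    by (rule sum.reindex_bij_betw[OF \<sigma>])
  have frame: "equiangular_frame n k (f \<circ> \<sigma>)"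
    unfolding equiangular_frame_def nk_frame_def o_def sum_eq
  proof (intro conjI)
    from f obtain b where
      "\<forall>i<n. \<forall>j<n. i \<noteq> j \<longrightarrow> cmod (normalized_vec (f i) \<bullet>c normalized_vec (f j)) = b"
      by (auto simp: equiangular_frame_def)
    then show "\<exists>b. \<forall>i<n. \<forall>j<n. i \<noteq> j \<longrightarrow>
        cmod (normalized_vec (f (\<sigma> i)) \<bullet>c normalized_vec (f (\<sigma> j))) = b"
      using lt ne by (intro exI[of _ b]) simp
  qed (use f lt in \<open>simp_all add: equiangular_frame_def nk_frame_def\<close>)
  have entry: "f (\<sigma> j) \<bullet>c f (\<sigma> i) =
      complex_of_real (real k / real n) * (if i = j then 1 else 0) +
      complex_of_real (frame_const n k) * Q $$ (\<sigma> i, \<sigma> j)" if "i < n" "j < n" for i j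
    using arg_cong[OF gram, of "\<lambda>M. M $$ (\<sigma> i, \<sigma> j)"] Qc lt[OF that(1)] lt[OF that(2)]
      ne[OF that] by (auto simp: gram_matrix_def)
  have "gram_matrix n (f \<circ> \<sigma>) =
      complex_of_real (real k / real n) \<cdot>\<^sub>m 1\<^sub>m n +
      complex_of_real (frame_const n k) \<cdot>\<^sub>m mat n n (\<lambda>(i, j). Q $$ (\<sigma> i, \<sigma> j))"
    by (rule eq_matI) (auto simp: gram_matrix_def entry)
  moreover have "mat_adjoint (mat n n (\<lambda>(i, j). Q $$ (\<sigma> i, \<sigma> j))) =
      mat n n (\<lambda>(i, j). Q $$ (\<sigma> i, \<sigma> j))"
  proof -
    have "Q $$ (i, j) = cnj (Q $$ (j, i))" if "i < n" "j < n" for i j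
      using Q mat_adjoint_eq_iff[OF Qc] that unfolding is_signature_matrix_def by blast
    then have herm: "Q $$ (\<sigma> i, \<sigma> j) = cnj (Q $$ (\<sigma> j, \<sigma> i))" if "i < n" "j < n" for i j
      using lt that by blast
    have index: "mat n n (\<lambda>(i, j). Q $$ (\<sigma> i, \<sigma> j)) $$ (i, j) = Q $$ (\<sigma> i, \<sigma> j)"
      if "i < n" "j < n" for i j
      using that by simp
    have "\<forall>i<n. \<forall>j<n. mat n n (\<lambda>(i, j). Q $$ (\<sigma> i, \<sigma> j)) $$ (i, j) =
        cnj (mat n n (\<lambda>(i, j). Q $$ (\<sigma> i, \<sigma> j)) $$ (j, i))"
    proof (intro allI impI)
      fix i j assume ij: "i < n" "j < n"
      show "mat n n (\<lambda>(i, j). Q $$ (\<sigma> i, \<sigma> j)) $$ (i, j) =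
          cnj (mat n n (\<lambda>(i, j). Q $$ (\<sigma> i, \<sigma> j)) $$ (j, i))"
        unfolding index[OF ij] index[OF ij(2) ij(1)] by (rule herm[OF ij])
    qed
    then show ?thesis
      by (rule mat_adjoint_eq_iff[OF mat_carrier, THEN iffD2])
  qed
  moreover have "\<forall>i<n. Q $$ (i, i) = 0" "\<forall>i<n. \<forall>j<n. i \<noteq> j \<longrightarrow> cmod (Q $$ (i, j)) = 1"
    by (rule Q[unfolded is_signature_matrix_def, THEN conjunct2, THEN conjunct2, THEN conjunct1]
      Q[unfolded is_signature_matrix_def, THEN conjunct2, THEN conjunct2, THEN conjunct2,
        THEN conjunct1])+
  then have "\<forall>i<n. mat n n (\<lambda>(i, j). Q $$ (\<sigma> i, \<sigma> j)) $$ (i, i) = 0"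
      "\<forall>i<n. \<forall>j<n. i \<noteq> j \<longrightarrow> cmod (mat n n (\<lambda>(i, j). Q $$ (\<sigma> i, \<sigma> j)) $$ (i, j)) = 1"
    using lt ne by simp_all
  ultimately show ?thesis
    unfolding is_signature_matrix_def
    by (intro conjI exI[of _ "f \<circ> \<sigma>"] mat_carrier frame)
qed

lemma quasi_signature_set_iff:
  assumes "group G" "finite (carrier G)" "S \<subseteq> carrier G - {\<one>\<^bsub>G\<^esub>}" and enum: "group_enum G enum"
  shows "quasi_signature_set G (Coset.order G + 1) k S \<longleftrightarrow>
    is_signature_matrix (Coset.order G + 1) k (bordered_mat (Coset.order G) (group_signature G enum S))"
proof
  show "quasi_signature_set G (Coset.order G + 1) k S"
    if "is_signature_matrix (Coset.order G + 1) k (bordered_mat (Coset.order G) (group_signature G enum S))"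
    using assms that by (auto simp: quasi_signature_set_def)
next
  assume "quasi_signature_set G (Coset.order G + 1) k S"
  then obtain enum' where enum': "group_enum G enum'" and
    sig: "is_signature_matrix (Coset.order G + 1) k (bordered_mat (Coset.order G) (group_signature G enum' S))"
    by (auto simp: quasi_signature_set_def)
  define m where "m = Coset.order G"
  define \<pi> where "\<pi> = the_inv_into {..<m} enum' \<circ> enum"
  define \<sigma> where "\<sigma> i = (case i of 0 \<Rightarrow> 0 | Suc i' \<Rightarrow> Suc (\<pi> i'))" for i
  have b: "bij_betw enum {..<m} (carrier G)" "bij_betw enum' {..<m} (carrier G)"
    using enum enum' by (auto simp: group_enum_def m_def)
  have \<pi>: "bij_betw \<pi> {..<m} {..<m}"
    unfolding \<pi>_def by (rule bij_betw_trans[OF b(1) bij_betw_the_inv_into[OF b(2)]])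
  have lt: "\<pi> i < m" if "i < m" for i
    using bij_betwE[OF \<pi>] that by auto
  have enum_\<pi>: "enum' (\<pi> i) = enum i" if "i < m" for i
    unfolding \<pi>_def o_def using b that by (intro f_the_inv_into_f_bij_betw) (auto dest: bij_betwE)
  have inj: "inj_on \<sigma> {..<m + 1}"
    using \<pi> by (auto simp: inj_on_def \<sigma>_def bij_betw_def split: nat.splits)
  moreover have "\<sigma> ` {..<m + 1} \<subseteq> {..<m + 1}"
    using lt by (auto simp: \<sigma>_def split: nat.splits)
  ultimately have "\<sigma> ` {..<m + 1} = {..<m + 1}"
    by (intro endo_inj_surj) auto
  with inj have \<sigma>: "bij_betw \<sigma> {..<m + 1} {..<m + 1}"
    by (simp add: bij_betw_def)
  let ?B' = "bordered_mat m (group_signature G enum' S)"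
  let ?B = "bordered_mat m (group_signature G enum S)"
  have S: "S \<subseteq> carrier G" using assms by auto
  have carr: "group_signature G e S \<in> carrier_mat m m" for e
    unfolding m_def by (rule group_signature_carrier)
  have "mat (m + 1) (m + 1) (\<lambda>(i, j). ?B' $$ (\<sigma> i, \<sigma> j)) = ?B"
  proof (rule eq_matI)
    fix i j assume "i < dim_row ?B" "j < dim_col ?B"
    then have ij: "i < m + 1" "j < m + 1"
      using bordered_mat_carrier[OF carr, of enum] by auto
    moreover have "\<sigma> i < m + 1" "\<sigma> j < m + 1"
      using ij bij_betwE[OF \<sigma>] by auto
    ultimately show "mat (m + 1) (m + 1) (\<lambda>(i, j). ?B' $$ (\<sigma> i, \<sigma> j)) $$ (i, j) = ?B $$ (i, j)"
      using lt enum_\<pi> assms(2) S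
      by (cases i; cases j)
        (simp_all add: index_bordered_mat[OF carr] \<sigma>_def index_group_signature m_def[symmetric])
  qed (use bordered_mat_carrier[OF carr, of enum] in auto)
  with is_signature_matrix_permute[OF sig[folded m_def] \<sigma>]
  show "is_signature_matrix (Coset.order G + 1) k (bordered_mat (Coset.order G) (group_signature G enum S))"
    by (simp add: m_def)
qed

abbreviation Zp :: "nat \<Rightarrow> int ring" where
  "Zp p \<equiv> residue_ring (int p)"

text \<open>
  The residue class of 2. It is reduced mod \<open>p\<close> because the carrier of \<^term>\<open>Zp p\<close> is
  \<open>{0, \<dots>, p - 1}\<close>; for \<open>p = 2\<close> it is zero, hence does not generate the multiplicative group.
\<close>

abbreviation two_mod :: "nat \<Rightarrow> int" where
  "two_mod p \<equiv> 2 mod int p"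

end

theory Submission
  imports Defs "HOL-Number_Theory.Euler_Criterion"
begin

text \<open>
  Write \<open>\<chi>\<close> for the Legendre symbol modulo \<open>p\<close>. Since 2 generates the multiplicative group, the
  group generated by \<open>2\<^sup>2\<close> consists of all nonzero squares, so the matrix \<open>Q\<close> of the problem is the
  Paley matrix with entries \<open>\<chi>(i - j)\<close>, and its bordered version is the candidate conference matrix
  (\<open>quadratic_residues_generated\<close>, \<open>paley_matrix_entry\<close>). Moreover 2 itself is not a square: otherwise
  every unit would be a square, so squaring would be injective on units, although 1 and \<open>- 1\<close> have the same square.

  A self-adjoint matrix is the Gram matrix of a Parseval frame for \<open>\<complex>\<^sup>k\<close> if and only if it is
  idempotent of trace \<open>k\<close>. Applied to \<open>P = (k/n) I + c M\<close>, this turns the question whether \<open>M\<close> is a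
  signature matrix into one about \<open>M\<^sup>2\<close>. In one direction (\<open>signature_matrix_square\<close>), off the
  diagonal \<open>M\<^sup>2\<close> must be \<open>(1 - 2k/n)/c\<close> times \<open>M\<close>. For the bordered Paley matrix, the
  off-diagonal entries of the square in the row of the border are sums of \<open>\<chi>\<close> over all residues,
  which vanish, so that \<open>k = n/2\<close>. In the other direction
  (\<open>signature_matrix_if_conference\<close>), if \<open>n = 2k\<close> and the rows of \<open>M\<close> are orthogonal, then \<open>P\<close> is
  idempotent of trace \<open>k\<close>, and splitting off rank one projections yields the frame
  (\<open>factorize_hermitian_idempotent\<close>).

  The rows of the bordered Paley matrix are orthogonal because \<open>\<chi>\<close> has sum 0 and its
  autocorrelation at every nonzero shift is \<open>- 1\<close> (\<open>legendre_autocorrelation\<close>), which the border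
  compensates by 1. What remains is self-adjointness, that is \<open>\<chi>(- 1) = 1\<close>, that is
  \<open>p \<equiv> 1 (mod 4)\<close>. As \<open>p \<equiv> 1 (mod 8)\<close> would make 2 a square (\<open>quadres_two_if_mod_8\<close>), this
  condition is the same as \<open>p \<equiv> 5 (mod 8)\<close>.
\<close>

section \<open>Subgroups generated by a square\<close>

lemma (in comm_group) subgroup_squares: "subgroup ((\<lambda>x. x \<otimes> x) ` carrier G) G"
proof (rule subgroupI)
  fix a b
  assume "a \<in> (\<lambda>x. x \<otimes> x) ` carrier G" and "b \<in> (\<lambda>x. x \<otimes> x) ` carrier G"
  then obtain x y where xy: "x \<in> carrier G" "y \<in> carrier G" and "a = x \<otimes> x" "b = y \<otimes> y"
    by auto
  then have "a \<otimes> b = (x \<otimes> y) \<otimes> (x \<otimes> y)" "inv a = inv x \<otimes> inv x"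
    by (simp_all add: m_ac inv_mult)
  then show "a \<otimes> b \<in> (\<lambda>x. x \<otimes> x) ` carrier G" "inv a \<in> (\<lambda>x. x \<otimes> x) ` carrier G"
    using xy by auto
qed auto

text \<open>
  In a cyclic group the squares of the powers of a generator are the powers of its square. The
  inclusion from right to left is an induction on how an element is generated; it uses that
  squaring is multiplicative in a commutative group.
\<close>

lemma (in comm_group) generate_square_eq_squares:
  assumes gen: "generate G {a} = carrier G"
  shows "generate G {a [^] (2::nat)} = (\<lambda>x. x \<otimes> x) ` carrier G"
proof
  have a: "a \<in> carrier G"
    using gen generate.incl[of a "{a}" G] by simp
  then have sq: "a [^] (2::nat) = a \<otimes> a"
    by (simp add: numeral_2_eq_2)
  show "generate G {a [^] (2::nat)} \<subseteq> (\<lambda>x. x \<otimes> x) ` carrier G"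
    by (rule generate_subgroup_incl[OF _ subgroup_squares]) (use a sq in auto)
  have "x \<in> carrier G \<and> x \<otimes> x \<in> generate G {a [^] (2::nat)}" if "x \<in> generate G {a}" for x
    using that
  proof (induction x rule: generate.induct)
    case one
    then show ?case by (simp add: generate.one)
  next
    case (incl h)
    then show ?case using a sq by (auto intro: generate.incl)
  next
    case (inv h)
    then have "inv h \<otimes> inv h = inv (a [^] (2::nat))"
      using a sq by (simp add: inv_mult)
    then show ?case using inv a by (auto intro: generate.inv)
  next
    case (eng x y)
    then have "(x \<otimes> y) \<otimes> (x \<otimes> y) = (x \<otimes> x) \<otimes> (y \<otimes> y)"
      by (simp add: m_ac)
    then show ?case using eng by (simp add: generate.eng)
  qed
  then show "(\<lambda>x. x \<otimes> x) ` carrier G \<subseteq> generate G {a [^] (2::nat)}"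
    using gen by auto
qed

text \<open>
  If a generator were a square, then all elements would be squares. Squaring would be a surjection
  of a finite set onto itself, hence injective, but an involution \<open>z\<close> has the same square as the
  identity.
\<close>

lemma (in comm_group) generator_not_square:
  assumes fin: "finite (carrier G)" and gen: "generate G {a} = carrier G"
    and z: "z \<in> carrier G" "z \<noteq> \<one>" "z \<otimes> z = \<one>"
  shows "a \<notin> (\<lambda>x. x \<otimes> x) ` carrier G"
proof
  assume "a \<in> (\<lambda>x. x \<otimes> x) ` carrier G"
  then have "carrier G \<subseteq> (\<lambda>x. x \<otimes> x) ` carrier G"
    using generate_subgroup_incl[OF _ subgroup_squares, of "{a}"] gen by simp
  then have "inj_on (\<lambda>x. x \<otimes> x) (carrier G)"
    using fin by (meson eq_card_imp_inj_on card_image_le card_mono finite_imageI le_antisym)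
  then show False
    using inj_onD[of "\<lambda>x. x \<otimes> x" "carrier G" z \<one>] z by simp
qed

section \<open>The Legendre symbol\<close>

text \<open>
  By Euler's criterion the two sides are congruent modulo \<open>p\<close>. They lie in \<open>{- 1, 0, 1}\<close>, so they
  differ by at most 2, which is less than \<open>p\<close>.
\<close>

lemma legendre_mult:
  assumes "prime p" "2 < p"
  shows "Legendre (a * b) (int p) = Legendre a (int p) * Legendre b (int p)"
proof -
  have "[Legendre (a * b) (int p) = (a * b) ^ ((p - 1) div 2)] (mod int p)"
    by (rule euler_criterion[OF assms])
  moreover have "[Legendre a (int p) * Legendre b (int p) =
      a ^ ((p - 1) div 2) * b ^ ((p - 1) div 2)] (mod int p)"
    by (intro cong_mult euler_criterion[OF assms])
  ultimately have "int p dvd Legendre (a * b) (int p) - Legendre a (int p) * Legendre b (int p)"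
    by (metis cong_iff_dvd_diff cong_sym cong_trans power_mult_distrib)
  moreover have "\<bar>Legendre (a * b) (int p) - Legendre a (int p) * Legendre b (int p)\<bar> < int p"
    using assms(2) by (auto simp: Legendre_def)
  ultimately show ?thesis
    using dvd_imp_le_int[of "Legendre (a * b) (int p) - Legendre a (int p) * Legendre b (int p)"]
    by fastforce
qed

lemma legendre_cong: "[a = b] (mod m) \<Longrightarrow> Legendre a m = Legendre b m"
  by (simp add: Legendre_def QuadRes_def cong_def)

lemma legendre_minus_one:
  assumes "prime p" "2 < p"
  shows "Legendre (- 1) (int p) = (- 1) ^ ((p - 1) div 2)"
proof -
  have "int p dvd Legendre (- 1) (int p) - (- 1) ^ ((p - 1) div 2)"
    using euler_criterion[OF assms] by (simp add: cong_iff_dvd_diff)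
  moreover have "\<bar>Legendre (- 1) (int p) - (- 1) ^ ((p - 1) div 2)\<bar> < int p"
    using assms(2) by (cases "even ((p - 1) div 2)") (auto simp: Legendre_def)
  ultimately show ?thesis
    using dvd_imp_le_int[of "Legendre (- 1) (int p) - (- 1) ^ ((p - 1) div 2)"] by fastforce
qed

text \<open>
  A primitive eighth root of unity \<open>z\<close> satisfies \<open>z\<^sup>4 = - 1\<close> and therefore \<open>(z - z\<^sup>3)\<^sup>2 = 2\<close>. If 2 were
  not a square, then by Euler's criterion \<open>2\<^bsup>(p - 1)/8\<^esup>\<close> would be such a root.
\<close>

lemma quadres_two_if_mod_8:
  assumes p: "prime p" and p8: "p mod 8 = 1"
  shows "QuadRes (int p) 2"
proof (rule ccontr)
  assume nq: "\<not> QuadRes (int p) 2"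
  have "p > 2" using p p8 prime_gt_1_nat[OF p] by (cases "p = 2") auto
  define z :: int where "z = 2 ^ ((p - 1) div 8)"
  have "(p - 1) div 2 = (p - 1) div 8 * 4" using p8 by presburger
  then have "z ^ 4 = 2 ^ ((p - 1) div 2)"
    unfolding z_def by (simp add: power_mult)
  moreover have "Legendre 2 (int p) = - 1"
    using nq \<open>p > 2\<close> by (auto simp: Legendre_def cong_def)
  ultimately have "[- 1 = z ^ 4] (mod int p)"
    using euler_criterion[OF p \<open>p > 2\<close>, of 2] by simp
  then have "[z ^ 4 = - 1] (mod int p)"
    by (rule cong_sym)
  then have "int p dvd z ^ 4 + 1"
    by (simp add: cong_iff_dvd_diff)
  then have "int p dvd (z ^ 4 + 1) * (z ^ 2 - 2)"
    by simp
  also have "(z ^ 4 + 1) * (z ^ 2 - 2) = (z - z ^ 3) ^ 2 - 2"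
    by (simp add: power2_eq_square power3_eq_cube power4_eq_xxxx algebra_simps)
  finally show False
    using nq by (auto simp: QuadRes_def cong_iff_dvd_diff)
qed

lemma legendre_of_dvd: "m dvd a \<Longrightarrow> Legendre a m = 0"
  by (simp add: Legendre_def cong_0_iff)

lemma legendre_square_one:
  assumes "\<not> m dvd a"
  shows "Legendre a m * Legendre a m = 1"
  using assms by (auto simp: Legendre_def cong_0_iff)

lemma legendre_one: "m > 1 \<Longrightarrow> Legendre 1 m = 1"
  unfolding Legendre_def QuadRes_def
  by (auto simp: cong_0_iff intro!: exI[of _ 1])

lemma legendre_mod: "Legendre (a mod m) m = Legendre a m"
  by (rule legendre_cong) simp

section \<open>Character sums over the residues\<close>

lemma mod_nonzero_range:
  fixes a m :: int
  assumes "m > 0" "\<not> m dvd a"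
  shows "a mod m \<in> {1..<m}"
proof -
  have "0 \<le> a mod m" "a mod m < m" "a mod m \<noteq> 0"
    using assms by (simp_all add: dvd_eq_mod_eq_0)
  then show ?thesis by simp
qed

lemma sum_residues_shift:
  fixes f :: "int \<Rightarrow> 'a::comm_monoid_add"
  assumes m: "m > 0" and per: "\<And>a. f (a mod m) = f a"
  shows "(\<Sum>x\<in>{0..<m}. f (x + c)) = (\<Sum>x\<in>{0..<m}. f x)"
proof (rule sum.reindex_bij_witness[of _ "\<lambda>x. (x - c) mod m" "\<lambda>x. (x + c) mod m"])
  fix x assume "x \<in> {0..<m}"
  then have x: "x mod m = x" by simp
  show "((x + c) mod m - c) mod m = x" "((x - c) mod m + c) mod m = x"
    using x by (simp_all add: mod_simps)
  show "(x + c) mod m \<in> {0..<m}" "(x - c) mod m \<in> {0..<m}"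
    using m by simp_all
  show "f ((x + c) mod m) = f (x + c)"
    by (rule per)
qed

lemma sum_residues_scale:
  fixes f :: "int \<Rightarrow> 'a::comm_monoid_add"
  assumes m: "m > 0" and per: "\<And>a. f (a mod m) = f a" and cop: "coprime u m"
  shows "(\<Sum>x\<in>{0..<m}. f (u * x)) = (\<Sum>x\<in>{0..<m}. f x)"
proof -
  obtain v where v: "[u * v = 1] (mod m)"
    using cop cong_solve_coprime_int by blast
  have uv: "u * (v * x) mod m = x mod m" "v * (u * x) mod m = x mod m" for x
    using cong_mult[OF v cong_refl[of x]] by (simp_all add: cong_def ac_simps)
  show ?thesis
  proof (rule sum.reindex_bij_witness[of _ "\<lambda>x. (v * x) mod m" "\<lambda>x. (u * x) mod m"])
    fix x assume "x \<in> {0..<m}"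
    then have x: "x mod m = x" by simp
    show "v * (u * x mod m) mod m = x" "u * (v * x mod m) mod m = x"
      using x uv by (simp_all add: mod_mult_right_eq)
    show "u * x mod m \<in> {0..<m}" "v * x mod m \<in> {0..<m}"
      using m by simp_all
    show "f (u * x mod m) = f (u * x)"
      by (rule per)
  qed
qed

lemma sum_int_lessThan: "(\<Sum>l<m. f (int l)) = (\<Sum>x\<in>{0..<int m}. f x)"
  by (rule sum.reindex_bij_witness[of _ nat int]) auto

text \<open>
  Multiplication by a nonresidue \<open>u\<close> permutes the residues and changes the sign of every term, so
  the sum equals its own negative.
\<close>

lemma sum_legendre:
  assumes p: "prime p" "2 < p" and u: "Legendre u (int p) = - 1"
  shows "(\<Sum>x\<in>{0..<int p}. Legendre x (int p)) = 0"
proof -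
  have "\<not> int p dvd u"
    using u legendre_of_dvd by fastforce
  then have "coprime u (int p)"
    using p by (meson coprime_commute prime_imp_coprime prime_nat_int_transfer)
  then have "(\<Sum>x\<in>{0..<int p}. Legendre (u * x) (int p)) = (\<Sum>x\<in>{0..<int p}. Legendre x (int p))"
    using p by (intro sum_residues_scale) (simp_all add: legendre_mod)
  then show ?thesis
    by (simp add: legendre_mult[OF p] u sum_negf)
qed

text \<open>
  Let \<open>A(c)\<close> be the sum in question. Rescaling the summation variable by a unit \<open>d\<close> shows
  \<open>A(d) = \<chi>(d)\<^sup>2 A(1) = A(1)\<close>, so \<open>A\<close> is constant away from 0. The sum of \<open>A(c)\<close> over all \<open>c\<close> is 0,
  because it contains the full sum of \<open>\<chi>\<close> as a factor, and \<open>A(0) = p - 1\<close>. Hence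
  \<open>(p - 1) + (p - 1) A(1) = 0\<close>.
\<close>

lemma legendre_autocorrelation:
  assumes p: "prime p" "2 < p" and u: "Legendre u (int p) = - 1" and c: "\<not> int p dvd c"
  shows "(\<Sum>x\<in>{0..<int p}. Legendre x (int p) * Legendre (x + c) (int p)) = - 1"
proof -
  define L where "L x = Legendre x (int p)" for x
  define A where "A c = (\<Sum>x\<in>{0..<int p}. L x * L (x + c))" for c
  have per: "L (x mod int p) = L x" for x
    by (simp add: L_def legendre_mod)
  have per': "L (x mod int p + d) = L (x + d)" for x d
    by (metis per mod_add_left_eq)
  have A_unit: "A d = A 1" if d: "d \<in> {1..<int p}" for d
  proof -
    have nd: "\<not> int p dvd d"
      using d zdvd_not_zless by auto
    then have "coprime d (int p)"
      using p by (meson coprime_commute prime_imp_coprime prime_nat_int_transfer)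
    then have "A d = (\<Sum>x\<in>{0..<int p}. L (d * x) * L (d * x + d))"
      unfolding A_def using p
      by (intro sum_residues_scale[symmetric, where f = "\<lambda>x. L x * L (x + d)"]) (simp_all add: per per')
    also have "\<dots> = (\<Sum>x\<in>{0..<int p}. (L d * L d) * (L x * L (x + 1)))"
    proof (rule sum.cong[OF refl])
      fix x
      have "L (d * x + d) = L d * L (x + 1)"
        unfolding L_def by (simp add: algebra_simps flip: legendre_mult[OF p])
      moreover have "L (d * x) = L d * L x"
        unfolding L_def by (rule legendre_mult[OF p])
      ultimately show "L (d * x) * L (d * x + d) = (L d * L d) * (L x * L (x + 1))"
        by simp
    qed
    also have "L d * L d = 1"
      using legendre_square_one[OF nd] by (simp add: L_def)
    finally show ?thesis by (simp add: A_def)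
  qed
  have A0: "A 0 = int p - 1"
  proof -
    have "A 0 = (\<Sum>x\<in>{0..<int p}. if x = 0 then 0 else 1)"
      unfolding A_def
    proof (rule sum.cong[OF refl])
      fix x assume "x \<in> {0..<int p}"
      then have "x = 0 \<or> \<not> int p dvd x"
        using zdvd_not_zless by fastforce
      then show "L x * L (x + 0) = (if x = 0 then 0 else 1)"
        using legendre_square_one[of "int p" x] legendre_of_dvd[of "int p" 0] by (auto simp: L_def)
    qed
    also have "{0..<int p} = insert 0 {1..<int p}"
      using p by auto
    also have "(\<Sum>x\<in>insert 0 {1..<int p}. if x = 0 then 0 else 1) = (\<Sum>x\<in>{1..<int p}. 1 :: int)"
      by (subst sum.insert) (auto intro: sum.cong)
    finally show ?thesis using p by simp
  qed
  have "(\<Sum>d\<in>{0..<int p}. A d) = (\<Sum>x\<in>{0..<int p}. L x * (\<Sum>d\<in>{0..<int p}. L (d + x)))"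
    unfolding A_def by (subst sum.swap) (simp add: sum_distrib_left add.commute)
  also have "\<dots> = 0"
  proof -
    have "(\<Sum>d\<in>{0..<int p}. L (d + x)) = 0" for x
      using p sum_residues_shift[of "int p" L x] sum_legendre[OF p u] per by (simp add: L_def)
    then show ?thesis by simp
  qed
  finally have "(\<Sum>d\<in>{0..<int p}. A d) = 0" .
  moreover have "{0..<int p} = insert 0 {1..<int p}"
    using p by auto
  ultimately have "A 0 + (\<Sum>d\<in>{1..<int p}. A d) = 0"
    by simp
  moreover have "(\<Sum>d\<in>{1..<int p}. A d) = (\<Sum>d\<in>{1..<int p}. A 1)"
    by (rule sum.cong[OF refl A_unit])
  ultimately have "(int p - 1) * (A 1 + 1) = 0"
    using p by (simp add: A0 algebra_simps)
  then have "A 1 = - 1"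
    using p by simp
  moreover have "A c = A (c mod int p)"
  proof -
    have "L (x + c mod int p) = L (x + c)" for x
      by (metis per mod_add_right_eq)
    then show ?thesis by (simp add: A_def)
  qed
  moreover have "c mod int p \<in> {1..<int p}"
    using c p by (intro mod_nonzero_range) simp_all
  ultimately have "A c = - 1"
    using A_unit[of "c mod int p"] by argo
  then show ?thesis by (simp add: A_def L_def)
qed

section \<open>The residues generated by 4\<close>

text \<open>
  The group-theoretic hypothesis enters only here. For \<open>p = 2\<close> it fails, because then the class
  of 2 is 0, which is not a unit. For \<open>p > 2\<close> the involution that shows 2 to be a nonresidue is
  \<open>- 1\<close>, represented by \<open>p - 1\<close>.
\<close>

lemma quadratic_residues_generated:
  assumes p: "prime p"
    and gen: "generate (mult_of (Zp p)) {two_mod p} = carrier (mult_of (Zp p))"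
  shows "2 < p"
    and "Legendre 2 (int p) = - 1"
    and "generate (mult_of (Zp p)) {two_mod p [^]\<^bsub>mult_of (Zp p)\<^esub> (2::nat)} =
      {x \<in> {0..<int p}. Legendre x (int p) = 1}"
proof -
  interpret R: residues_prime p "Zp p"
    by unfold_locales (use p in simp_all)
  have carr: "carrier (mult_of (Zp p)) = {1..<int p}"
    by (auto simp: R.res_carrier_eq R.res_zero_eq)
  have mult: "x \<otimes>\<^bsub>mult_of (Zp p)\<^esub> y = x * y mod int p" for x y
    by (simp add: R.res_mult_eq)
  have one: "\<one>\<^bsub>mult_of (Zp p)\<^esub> = 1"
    by (simp add: R.res_one_eq)
  interpret M: comm_group "mult_of (Zp p)"
    by (metis R.units_comm_group R.mult_of_is_Units)
  have two: "two_mod p \<in> carrier (mult_of (Zp p))"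
    using gen generate.incl[of "two_mod p" "{two_mod p}" "mult_of (Zp p)"] by simp
  show p2: "2 < p"
    using two prime_ge_2_nat[OF p] unfolding carr by (cases "p = 2") auto
  have sq: "x \<in> (\<lambda>y. y \<otimes>\<^bsub>mult_of (Zp p)\<^esub> y) ` carrier (mult_of (Zp p)) \<longleftrightarrow>
      x \<in> {0..<int p} \<and> Legendre x (int p) = 1" for x
  proof
    assume "x \<in> (\<lambda>y. y \<otimes>\<^bsub>mult_of (Zp p)\<^esub> y) ` carrier (mult_of (Zp p))"
    then obtain y where y: "y \<in> {1..<int p}" and x: "x = y * y mod int p"
      unfolding carr mult by auto
    have "\<not> int p dvd y"
      using y zdvd_not_zless by auto
    then have "Legendre x (int p) = 1"
      by (simp add: x legendre_mod legendre_mult[OF p p2] legendre_square_one)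
    then show "x \<in> {0..<int p} \<and> Legendre x (int p) = 1"
      using p2 by (simp add: x)
  next
    assume x: "x \<in> {0..<int p} \<and> Legendre x (int p) = 1"
    then have nz: "\<not> [x = 0] (mod int p)" and "QuadRes (int p) x"
      by (auto simp: Legendre_def split: if_splits)
    then obtain y where y: "[y\<^sup>2 = x] (mod int p)"
      by (auto simp: QuadRes_def)
    have "\<not> int p dvd y"
    proof
      assume "int p dvd y"
      then have "[y\<^sup>2 = 0] (mod int p)"
        by (simp add: cong_0_iff power2_eq_square)
      then show False
        using y nz by (metis cong_sym cong_trans)
    qed
    then have ym: "y mod int p \<in> {1..<int p}"
      using p2 by (intro mod_nonzero_range) simp_all
    have "x mod int p = x"
      by (rule mod_pos_pos_trivial) (use x in auto)
    then have "x = y * y mod int p"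
      using y unfolding cong_def power2_eq_square by argo
    also have "\<dots> = (y mod int p) * (y mod int p) mod int p"
      by (rule mod_mult_eq[symmetric])
    finally show "x \<in> (\<lambda>y. y \<otimes>\<^bsub>mult_of (Zp p)\<^esub> y) ` carrier (mult_of (Zp p))"
      unfolding mult carr using ym by (rule image_eqI)
  qed
  then show "generate (mult_of (Zp p)) {two_mod p [^]\<^bsub>mult_of (Zp p)\<^esub> (2::nat)} =
      {x \<in> {0..<int p}. Legendre x (int p) = 1}"
    unfolding M.generate_square_eq_squares[OF gen] by blast
  have "(int p - 1) * (int p - 1) mod int p = 1"
  proof -
    have "(int p - 1) * (int p - 1) = 1 + (int p - 2) * int p"
      by (simp add: algebra_simps)
    then show ?thesis using p2 by (simp only: mod_mult_self1) simp
  qed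
  then have "two_mod p \<notin> (\<lambda>y. y \<otimes>\<^bsub>mult_of (Zp p)\<^esub> y) ` carrier (mult_of (Zp p))"
    using p2
    by (intro M.generator_not_square[OF _ gen, of "int p - 1"], unfold carr mult one) simp_all
  then have "\<not> (two_mod p \<in> {0..<int p} \<and> Legendre (two_mod p) (int p) = 1)"
    unfolding sq .
  moreover have "two_mod p \<in> {0..<int p}"
    using p2 by simp
  ultimately have "Legendre 2 (int p) \<noteq> 1"
    unfolding legendre_mod by blast
  moreover have "\<not> [2 = 0] (mod int p)"
    using p2 zdvd_not_zless[of 2 "int p"] by (simp add: cong_0_iff)
  ultimately show "Legendre 2 (int p) = - 1"
    by (simp add: Legendre_def split: if_splits)
qed

section \<open>Gram matrices of Parseval frames\<close>

text \<open>
  A Hermitian idempotent \<open>P\<close> of trace \<open>k\<close> is a sum of \<open>k\<close> projections onto orthonormal vectors.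
  The trace is the sum of the squared absolute values of all entries. So it is 0 only for \<open>P = 0\<close>;
  otherwise some diagonal entry is nonzero. Then a column \<open>u\<close> of \<open>P\<close>, normalized, is a unit vector
  fixed by \<open>P\<close>, and \<open>P - u u\<^sup>*\<close> is again a Hermitian idempotent, of trace \<open>k - 1\<close>. It annihilates
  \<open>u\<close>, so \<open>u\<close> is orthogonal to all vectors that the induction hypothesis supplies.
\<close>

lemma factorize_hermitian_idempotent:
  fixes P :: "nat \<Rightarrow> nat \<Rightarrow> complex"
  assumes "\<And>i j. i < n \<Longrightarrow> j < n \<Longrightarrow> P j i = cnj (P i j)"
    and "\<And>i j. i < n \<Longrightarrow> j < n \<Longrightarrow> (\<Sum>l<n. P i l * P l j) = P i j"
    and "(\<Sum>i<n. P i i) = of_nat k"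
  shows "\<exists>v :: nat \<Rightarrow> nat \<Rightarrow> complex.
    (\<forall>i<n. \<forall>j<n. P i j = (\<Sum>a<k. v a i * cnj (v a j))) \<and>
    (\<forall>a<k. \<forall>b<k. (\<Sum>i<n. v a i * cnj (v b i)) = (if a = b then 1 else 0))"
  using assms
proof (induction k arbitrary: P)
  case (0 P)
  have diag: "P i i = of_real (\<Sum>l<n. (cmod (P i l))\<^sup>2)" if "i < n" for i
  proof -
    have "P i i = (\<Sum>l<n. P i l * cnj (P i l))"
      using 0(1,2) that by (metis (no_types, lifting) lessThan_iff sum.cong)
    then show ?thesis by (simp add: complex_norm_square del: of_real_power)
  qed
  have "of_real (\<Sum>i<n. \<Sum>l<n. (cmod (P i l))\<^sup>2) = (0 :: complex)"
    using 0(3) by (simp add: diag)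
  then have "(\<Sum>i<n. \<Sum>l<n. (cmod (P i l))\<^sup>2) = 0"
    by (simp only: of_real_eq_0_iff)
  then have "\<forall>i<n. \<forall>l<n. P i l = 0"
    by (simp add: sum_nonneg_eq_0_iff sum_nonneg)
  then show ?case by simp
next
  case (Suc k P)
  note herm = Suc(2) and idem = Suc(3)
  obtain j where j: "j < n" and Pj: "P j j \<noteq> 0"
  proof (rule ccontr)
    assume "\<not> thesis"
    then have "\<forall>i<n. P i i = 0" using that by blast
    then have "(of_nat (Suc k) :: complex) = 0" using Suc(4) by simp
    then show False by (simp only: of_nat_eq_0_iff nat.distinct)
  qed
  define d where "d = (\<Sum>l<n. (cmod (P l j))\<^sup>2)"
  have col: "(\<Sum>l<n. P l j * cnj (P l j)) = P j j"
  proof -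
    have "(\<Sum>l<n. P l j * cnj (P l j)) = (\<Sum>l<n. P j l * P l j)"
      by (intro sum.cong refl) (simp add: herm[OF _ j] mult.commute)
    then show ?thesis using idem j by simp
  qed
  then have d: "P j j = of_real d"
    by (simp add: d_def complex_norm_square del: of_real_power)
  have "d > 0"
  proof -
    have "d \<ge> 0" by (simp add: d_def sum_nonneg)
    moreover have "d \<noteq> 0" using Pj d by auto
    ultimately show ?thesis by simp
  qed
  then have dd: "complex_of_real (sqrt d) * complex_of_real (sqrt d) = of_real d"
      "complex_of_real (sqrt d) \<noteq> 0"
    by (simp_all flip: of_real_mult)
  define u where "u i = P i j / of_real (sqrt d)" for i
  have norm_u: "(\<Sum>i<n. u i * cnj (u i)) = 1"
    using col \<open>d > 0\<close> by (simp add: u_def dd d flip: sum_divide_distrib)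
  have Pu: "(\<Sum>l<n. P i l * u l) = u i" if "i < n" for i
    using idem[OF that j] by (simp add: u_def flip: sum_divide_distrib)
  have uP: "(\<Sum>l<n. cnj (u l) * P l m) = cnj (u m)" if "m < n" for m
  proof -
    have "(\<Sum>l<n. cnj (u l) * P l m) = cnj (\<Sum>l<n. P m l * u l)"
      by (simp add: herm[OF that] mult.commute)
    then show ?thesis using Pu that by simp
  qed
  define P' where "P' i l = P i l - u i * cnj (u l)" for i l
  have herm': "P' l i = cnj (P' i l)" if "i < n" "l < n" for i l
    using herm[OF that] by (simp add: P'_def mult.commute)
  have P'u: "(\<Sum>l<n. P' i l * u l) = 0" if "i < n" for i
  proof -
    have "(\<Sum>l<n. P' i l * u l) = (\<Sum>l<n. P i l * u l) - u i * (\<Sum>l<n. u l * cnj (u l))"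
      by (simp add: P'_def algebra_simps sum_subtractf sum_distrib_left)
    then show ?thesis using Pu that norm_u by simp
  qed
  have idem': "(\<Sum>l<n. P' i l * P' l m) = P' i m" if "i < n" "m < n" for i m
  proof -
    have "(\<Sum>l<n. P' i l * P' l m) =
        (\<Sum>l<n. P' i l * P l m) - (\<Sum>l<n. P' i l * u l) * cnj (u m)"
      by (simp add: P'_def[of _ m] algebra_simps sum_subtractf sum_distrib_left)
    also have "\<dots> = (\<Sum>l<n. P i l * P l m) - u i * (\<Sum>l<n. cnj (u l) * P l m)"
      by (simp add: P'u that) (simp add: P'_def algebra_simps sum_subtractf sum_distrib_left)
    finally show ?thesis
      using that idem uP by (simp add: P'_def)
  qed
  have tr': "(\<Sum>i<n. P' i i) = of_nat k"
    using Suc(4) norm_u by (simp add: P'_def sum_subtractf)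
  obtain v where v: "\<And>i l. i < n \<Longrightarrow> l < n \<Longrightarrow> P' i l = (\<Sum>a<k. v a i * cnj (v a l))"
    and orth: "\<And>a b. a < k \<Longrightarrow> b < k \<Longrightarrow>
      (\<Sum>i<n. v a i * cnj (v b i)) = (if a = b then 1 else 0)"
    using Suc.IH[OF herm' idem' tr'] by blast
  have perp: "(\<Sum>i<n. u i * cnj (v a i)) = 0" if a: "a < k" for a
  proof -
    \<comment> \<open>The inner product of \<open>v a\<close> with \<open>P' u = 0\<close>, where \<open>P'\<close> is expanded in the vectors \<open>v b\<close>.\<close>
    have "0 = (\<Sum>i<n. cnj (v a i) * (\<Sum>l<n. P' i l * u l))"
      by (simp add: P'u)
    also have "\<dots> = (\<Sum>i<n. \<Sum>l<n. \<Sum>b<k. (v b i * cnj (v a i)) * (u l * cnj (v b l)))"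
      by (simp add: v sum_distrib_left sum_distrib_right ac_simps)
    also have "\<dots> = (\<Sum>b<k. \<Sum>i<n. \<Sum>l<n. (v b i * cnj (v a i)) * (u l * cnj (v b l)))"
      by (subst sum.swap[of _ _ "{..<k}"], rule sum.cong[OF refl], rule sum.swap)
    also have "\<dots> = (\<Sum>b<k. (\<Sum>i<n. v b i * cnj (v a i)) * (\<Sum>l<n. u l * cnj (v b l)))"
      by (simp only: sum_product)
    also have "\<dots> = (\<Sum>b<k. if b = a then \<Sum>l<n. u l * cnj (v b l) else 0)"
      using a by (intro sum.cong) (auto simp: orth)
    also have "\<dots> = (\<Sum>l<n. u l * cnj (v a l))"
      using a by simp
    finally show ?thesis by simp
  qed
  have perp': "(\<Sum>i<n. v a i * cnj (u i)) = 0" if "a < k" for a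
  proof -
    have "(\<Sum>i<n. v a i * cnj (u i)) = cnj (\<Sum>i<n. u i * cnj (v a i))"
      by (simp add: mult.commute)
    then show ?thesis using perp[OF that] by simp
  qed
  \<comment> \<open>The new vector takes the index \<open>k\<close>, which the induction hypothesis leaves free.\<close>
  define w where "w = v(k := u)"
  have "P i l = (\<Sum>a<Suc k. w a i * cnj (w a l))" if "i < n" "l < n" for i l
    using v[OF that] by (simp add: w_def P'_def algebra_simps)
  moreover have "(\<Sum>i<n. w a i * cnj (w b i)) = (if a = b then 1 else 0)"
    if "a < Suc k" "b < Suc k" for a b
    using that norm_u perp perp' orth by (auto simp: w_def less_Suc_eq)
  ultimately show ?case by blast
qed

lemma cvec_norm_square: "complex_of_real ((cvec_norm x)\<^sup>2) = x \<bullet>c x"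
proof -
  have "x \<bullet>c x = of_real (\<Sum>i<dim_vec x. (cmod (x $ i))\<^sup>2)"
    by (simp add: scalar_prod_def complex_norm_square atLeast0LessThan del: of_real_power)
  moreover have "(\<Sum>i<dim_vec x. (cmod (x $ i))\<^sup>2) \<ge> 0"
    by (rule sum_nonneg) simp
  ultimately show ?thesis
    by (simp add: cvec_norm_def)
qed

text \<open>
  The orthonormal vectors of the factorization are the (conjugated) rows of the \<open>k \<times> n\<close> matrix whose
  columns are the frame vectors. The factorization gives the Gram matrix, and orthonormality of the
  rows is the Parseval identity.
\<close>

lemma frame_of_idempotent:
  fixes P :: "nat \<Rightarrow> nat \<Rightarrow> complex"
  assumes herm: "\<And>i j. i < n \<Longrightarrow> j < n \<Longrightarrow> P j i = cnj (P i j)"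
    and idem: "\<And>i j. i < n \<Longrightarrow> j < n \<Longrightarrow> (\<Sum>l<n. P i l * P l j) = P i j"
    and tr: "(\<Sum>i<n. P i i) = of_nat k"
    and k: "1 \<le> k" "k < n"
  obtains f where "nk_frame n k f" "\<And>i j. i < n \<Longrightarrow> j < n \<Longrightarrow> f j \<bullet>c f i = P i j"
proof -
  obtain v :: "nat \<Rightarrow> nat \<Rightarrow> complex"
    where v: "\<And>i j. i < n \<Longrightarrow> j < n \<Longrightarrow> P i j = (\<Sum>a<k. v a i * cnj (v a j))"
    and orth: "\<And>a b. a < k \<Longrightarrow> b < k \<Longrightarrow>
      (\<Sum>i<n. v a i * cnj (v b i)) = (if a = b then 1 else 0)"
    using factorize_hermitian_idempotent[of n P k, OF herm idem tr] by blast
  define f where "f j = vec k (\<lambda>a. cnj (v a j))" for j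
  have gram: "f j \<bullet>c f i = P i j" if "i < n" "j < n" for i j
    using v[OF that] by (simp add: f_def scalar_prod_def atLeast0LessThan mult.commute)
  have "(\<Sum>j<n. (cmod (x \<bullet>c f j))\<^sup>2) = (cvec_norm x)\<^sup>2" if x: "x \<in> carrier_vec k" for x
  proof -
    have xf: "x \<bullet>c f j = (\<Sum>a<k. x $ a * v a j)" for j
      using x by (simp add: f_def scalar_prod_def atLeast0LessThan)
    have "complex_of_real (\<Sum>j<n. (cmod (x \<bullet>c f j))\<^sup>2) =
        (\<Sum>j<n. \<Sum>a<k. \<Sum>b<k. x $ a * cnj (x $ b) * (v a j * cnj (v b j)))"
      by (simp add: complex_norm_square xf sum_product ac_simps del: of_real_power)
    also have "\<dots> = (\<Sum>a<k. \<Sum>b<k. \<Sum>j<n. x $ a * cnj (x $ b) * (v a j * cnj (v b j)))"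
      by (subst sum.swap, rule sum.cong[OF refl], rule sum.swap)
    also have "\<dots> = (\<Sum>a<k. \<Sum>b<k. if a = b then x $ a * cnj (x $ b) else 0)"
      by (intro sum.cong refl) (simp add: orth flip: sum_distrib_left)
    also have "\<dots> = x \<bullet>c x"
      using x by (simp add: scalar_prod_def atLeast0LessThan)
    also have "\<dots> = complex_of_real ((cvec_norm x)\<^sup>2)"
      by (rule cvec_norm_square[symmetric])
    finally show ?thesis
      by (simp only: of_real_eq_iff)
  qed
  then have "nk_frame n k f"
    using k by (simp add: nk_frame_def f_def)
  with gram show ?thesis
    using that by blast
qed

lemma cmod_normalized_inner:
  assumes "x \<in> carrier_vec k" "y \<in> carrier_vec k"
  shows "cmod (normalized_vec x \<bullet>c normalized_vec y) = cmod (x \<bullet>c y) / (cvec_norm x * cvec_norm y)"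
proof -
  have "normalized_vec x \<bullet>c normalized_vec y =
      complex_of_real (1 / cvec_norm x) * (complex_of_real (1 / cvec_norm y) * (x \<bullet>c y))"
    using assms by (simp add: normalized_vec_def conjugate_smult_vec)
  moreover have "cvec_norm z \<ge> 0" for z
    by (simp add: cvec_norm_def scalar_prod_def sum_nonneg)
  ultimately show ?thesis
    by (simp add: norm_mult norm_divide)
qed

text \<open>
  For \<open>n = 2k\<close> the frame constant satisfies \<open>c\<^sup>2 (n - 1) = 1/4\<close>. Since orthogonality of the rows means
  \<open>Q\<^sup>2 = (n - 1) I\<close>, the matrix \<open>P = (1/2) I + c Q\<close> is an idempotent of trace \<open>k\<close>.
\<close>

lemma signature_matrix_if_conference:
  assumes Q: "Q \<in> carrier_mat n n" and adj: "mat_adjoint Q = Q"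
    and diag: "\<And>i. i < n \<Longrightarrow> Q $$ (i, i) = 0"
    and unim: "\<And>i j. i < n \<Longrightarrow> j < n \<Longrightarrow> i \<noteq> j \<Longrightarrow> cmod (Q $$ (i, j)) = 1"
    and orth: "\<And>i j. i < n \<Longrightarrow> j < n \<Longrightarrow> i \<noteq> j \<Longrightarrow> (\<Sum>l<n. Q $$ (i, l) * Q $$ (l, j)) = 0"
    and n: "n = 2 * k" and k: "1 \<le> k"
  shows "is_signature_matrix n k Q"
proof -
  have herm: "Q $$ (j, i) = cnj (Q $$ (i, j))" if "i < n" "j < n" for i j
    using adj mat_adjoint_eq_iff[OF Q] that by blast
  define c where "c = frame_const n k"
  have "real n - 1 > 0"
    using n k by simp
  then have c2: "c * c * (real n - 1) = 1 / 4"
    using n k by (simp add: c_def frame_const_def field_simps power2_eq_square)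
  have sq: "(\<Sum>l<n. Q $$ (i, l) * Q $$ (l, j)) = (if i = j then of_real (real n - 1) else 0)"
    if "i < n" "j < n" for i j
  proof (cases "i = j")
    case True
    have "(\<Sum>l<n. Q $$ (i, l) * Q $$ (l, i)) = (\<Sum>l<n. if l = i then 0 else 1)"
    proof (rule sum.cong[OF refl])
      fix l assume "l \<in> {..<n}"
      then have "Q $$ (i, l) * Q $$ (l, i) = of_real ((cmod (Q $$ (i, l)))\<^sup>2)"
        using herm[of i l] that by (simp only: complex_norm_square lessThan_iff)
      then show "Q $$ (i, l) * Q $$ (l, i) = (if l = i then 0 else 1)"
        using \<open>l \<in> {..<n}\<close> that diag unim by auto
    qed
    also have "\<dots> = of_nat (card ({..<n} - {i}))"
      by (simp add: sum.If_cases Diff_eq)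
    finally show ?thesis
      using True that by simp
  qed (use orth that in simp)
  define P where "P i j = (if i = j then 1 / 2 else 0) + complex_of_real c * Q $$ (i, j)" for i j
  have hermP: "P j i = cnj (P i j)" if "i < n" "j < n" for i j
    using that unfolding P_def by (subst herm) auto
  have idemP: "(\<Sum>l<n. P i l * P l j) = P i j" if ij: "i < n" "j < n" for i j
  proof -
    have "P i l * P l j = (if l = i then P l j / 2 else 0) +
        (if l = j then complex_of_real c * Q $$ (i, l) / 2 else 0) +
        complex_of_real (c * c) * (Q $$ (i, l) * Q $$ (l, j))" for l
      by (auto simp: P_def algebra_simps)
    then have "(\<Sum>l<n. P i l * P l j) = P i j / 2 + complex_of_real c * Q $$ (i, j) / 2 +
        complex_of_real (c * c) * (\<Sum>l<n. Q $$ (i, l) * Q $$ (l, j))"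
      using ij by (simp add: sum.distrib flip: sum_distrib_left)
    also have "complex_of_real (c * c) * (\<Sum>l<n. Q $$ (i, l) * Q $$ (l, j)) =
        (if i = j then of_real (c * c * (real n - 1)) else 0)"
      using sq[OF ij] by (simp only: of_real_mult mult_zero_right split: if_split) simp
    also have "P i j / 2 + complex_of_real c * Q $$ (i, j) / 2 +
        (if i = j then of_real (c * c * (real n - 1)) else 0) = P i j"
      unfolding c2 by (simp add: P_def field_simps)
    finally show ?thesis .
  qed
  have trP: "(\<Sum>i<n. P i i) = of_nat k"
    using n diag by (simp add: P_def)
  have "k < n"
    using n k by simp
  obtain f where f: "nk_frame n k f"
    and gram: "\<And>i j. i < n \<Longrightarrow> j < n \<Longrightarrow> f j \<bullet>c f i = P i j"
    using frame_of_idempotent[of n P k, OF hermP idemP trP k \<open>k < n\<close>] by blast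
  have fc: "f j \<in> carrier_vec k" if "j < n" for j
    using f that by (simp add: nk_frame_def)
  have fnorm: "cvec_norm (f j) = sqrt (1 / 2)" if "j < n" for j
    using diag that by (simp add: cvec_norm_def gram P_def)
  have "f j \<noteq> 0\<^sub>v k" if "j < n" for j
    using gram[OF that that] diag that fc[OF that] by (auto simp: P_def)
  moreover have "cmod (normalized_vec (f i) \<bullet>c normalized_vec (f j)) = 2 * \<bar>c\<bar>"
    if "i < n" "j < n" "i \<noteq> j" for i j
    using that unim[of j i]
    by (simp add: cmod_normalized_inner[OF fc fc] gram fnorm P_def norm_mult)
  ultimately have "equiangular_frame n k f"
    using f by (auto simp: equiangular_frame_def)
  moreover have "gram_matrix n f =
      complex_of_real (real k / real n) \<cdot>\<^sub>m 1\<^sub>m n + complex_of_real (frame_const n k) \<cdot>\<^sub>m Q"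
    by (rule eq_matI) (use Q n k in \<open>auto simp: gram_matrix_def gram P_def c_def\<close>)
  ultimately show ?thesis
    unfolding is_signature_matrix_def using Q adj diag unim by blast
qed

text \<open>
  The two sides differ by a sesquilinear form \<open>B\<close> that vanishes on the diagonal. Expanding it at
  \<open>x + y\<close> and at \<open>x + \<i> y\<close> gives \<open>B x y + B y x = 0\<close> and \<open>- B x y + B y x = 0\<close>.
\<close>

lemma parseval_polarized:
  assumes f: "nk_frame n k f" and x: "x \<in> carrier_vec k" and y: "y \<in> carrier_vec k"
  shows "(\<Sum>l<n. (x \<bullet>c f l) * (f l \<bullet>c y)) = x \<bullet>c y"
proof -
  have fc: "f l \<in> carrier_vec k" if "l < n" for l
    using f that by (simp add: nk_frame_def)
  have comm: "f l \<bullet>c z = cnj (z \<bullet>c f l)" if "l < n" "z \<in> carrier_vec k" for l z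
    using fc[OF that(1)] that(2) by (simp add: scalar_prod_def mult.commute)
  define B where "B u v = (\<Sum>l<n. (u \<bullet>c f l) * (f l \<bullet>c v)) - u \<bullet>c v" for u v
  have B0: "B z z = 0" if "z \<in> carrier_vec k" for z
  proof -
    have "(\<Sum>l<n. (z \<bullet>c f l) * (f l \<bullet>c z)) = of_real (\<Sum>l<n. (cmod (z \<bullet>c f l))\<^sup>2)"
      using that by (simp add: comm complex_norm_square del: of_real_power)
    also have "\<dots> = of_real ((cvec_norm z)\<^sup>2)"
      using f that by (simp add: nk_frame_def)
    finally show ?thesis
      by (simp only: B_def cvec_norm_square diff_self)
  qed
  have add: "B (x + t \<cdot>\<^sub>v y) (x + t \<cdot>\<^sub>v y) = B x x + cnj t * B x y + t * B y x + t * cnj t * B y y" for t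
    using x y fc
    by (simp add: B_def add_scalar_prod_distrib[of _ k] scalar_prod_add_distrib[of _ k]
        conjugate_add_vec[of _ k] conjugate_smult_vec algebra_simps sum.distrib sum_distrib_left
        cong: sum.cong_simp)
  have "B x y + B y x = 0"
    using add[of 1] B0 x y by simp
  moreover have "- B x y + B y x = 0"
    using add[of \<i>] B0 x y by (simp add: algebra_simps)
  ultimately have "B x y = 0" by (simp add: add_eq_0_iff)
  then show ?thesis by (simp add: B_def)
qed

text \<open>
  The polarized Parseval identity, applied to the frame vectors themselves, says that their Gram
  matrix \<open>(k/n) I + c Q\<close> is idempotent. Comparing off-diagonal entries gives
  \<open>2 (k/n) c Q + c\<^sup>2 Q\<^sup>2 = c Q\<close>, and one factor \<open>c > 0\<close> cancels.
\<close>

lemma signature_matrix_square: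
  assumes sig: "is_signature_matrix n k Q" and ij: "i < n" "j < n" "i \<noteq> j"
  shows "frame_const n k > 0"
    and "complex_of_real (frame_const n k) * (\<Sum>l<n. Q $$ (i, l) * Q $$ (l, j)) =
      complex_of_real (1 - 2 * real k / real n) * Q $$ (i, j)"
proof -
  from sig have Q: "Q \<in> carrier_mat n n" and diag: "\<And>i. i < n \<Longrightarrow> Q $$ (i, i) = 0"
    by (simp_all add: is_signature_matrix_def)
  from sig obtain f where f: "nk_frame n k f"
    and gram: "gram_matrix n f =
      complex_of_real (real k / real n) \<cdot>\<^sub>m 1\<^sub>m n + complex_of_real (frame_const n k) \<cdot>\<^sub>m Q"
    by (auto simp: is_signature_matrix_def equiangular_frame_def)
  define c where "c = frame_const n k"
  define r where "r = real k / real n"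
  have k: "1 \<le> k" "k < n"
    using f by (simp_all add: nk_frame_def)
  show c: "frame_const n k > 0"
    using k by (simp add: frame_const_def)
  have fc: "f l \<in> carrier_vec k" if "l < n" for l
    using f that by (simp add: nk_frame_def)
  have G: "f b \<bullet>c f a = (if a = b then of_real r else 0) + of_real c * Q $$ (a, b)"
    if "a < n" "b < n" for a b
    using arg_cong[OF gram, of "\<lambda>M. M $$ (a, b)"] Q that
    by (auto simp: gram_matrix_def c_def r_def)
  have "of_real c * Q $$ (i, j) = f j \<bullet>c f i"
    using G ij by simp
  also have "\<dots> = (\<Sum>l<n. (f l \<bullet>c f i) * (f j \<bullet>c f l))"
    using parseval_polarized[OF f fc fc, of j i] ij by (simp add: mult.commute)
  also have "\<dots> = (\<Sum>l<n. (if l = i then of_real (r * c) * Q $$ (l, j) else 0) +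
      (if l = j then of_real (r * c) * Q $$ (i, l) else 0) +
      of_real (c * c) * (Q $$ (i, l) * Q $$ (l, j)))"
    using ij by (intro sum.cong refl) (auto simp: G algebra_simps)
  also have "\<dots> = of_real (2 * r * c) * Q $$ (i, j) +
      of_real (c * c) * (\<Sum>l<n. Q $$ (i, l) * Q $$ (l, j))"
    using ij by (simp add: sum.distrib flip: sum_distrib_left)
  finally have "of_real c * (of_real c * (\<Sum>l<n. Q $$ (i, l) * Q $$ (l, j))) =
      complex_of_real c * (of_real (1 - 2 * r) * Q $$ (i, j))"
    by (simp add: algebra_simps)
  then show "complex_of_real (frame_const n k) * (\<Sum>l<n. Q $$ (i, l) * Q $$ (l, j)) =
      complex_of_real (1 - 2 * real k / real n) * Q $$ (i, j)"
    using c by (simp add: c_def r_def)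
qed

section \<open>The bordered Paley matrix\<close>

definition paley_matrix :: "nat \<Rightarrow> complex mat" where
  "paley_matrix p = group_signature (add_monoid (Zp p)) int {x \<in> {0..<int p}. Legendre x (int p) = 1}"

lemma paley_matrix_entry:
  assumes p: "prime p" and ij: "i < p" "j < p"
  shows "paley_matrix p $$ (i, j) =
    of_int (Legendre (int i - int j) (int p))"
proof -
  interpret R: residues_prime p "Zp p"
    by unfold_locales (use p in simp_all)
  define d where "d = (int i - int j) mod int p"
  have ord: "Coset.order (add_monoid (Zp p)) = p"
    by (simp add: Coset.order_def R.res_carrier_eq)
  have eq: "int i = (g + int j) mod int p \<longleftrightarrow> g = d" if "g \<in> {0..<int p}" for g
  proof -
    have "int i mod int p = int i" "g mod int p = g"
      using ij that by simp_all
    then show ?thesis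
      unfolding d_def by (metis add_diff_cancel_right' diff_add_cancel mod_add_left_eq mod_diff_left_eq)
  qed
  have count: "(\<Sum>g\<in>X. if int i = g \<otimes>\<^bsub>add_monoid (Zp p)\<^esub> int j then 1 else 0) =
      (if d \<in> X then 1 else (0::complex))" if X: "X \<subseteq> {0..<int p}" for X
  proof -
    have "(\<Sum>g\<in>X. if int i = g \<otimes>\<^bsub>add_monoid (Zp p)\<^esub> int j then 1 else 0) =
        (\<Sum>g\<in>X. if g = d then 1 else (0::complex))"
      using X by (intro sum.cong refl) (auto simp: R.res_add_eq eq)
    then show ?thesis
      using X finite_subset[OF X] by simp
  qed
  let ?S = "{x \<in> {0..<int p}. Legendre x (int p) = 1}"
  have d: "d \<in> {0..<int p}"
    using prime_gt_0_nat[OF p] by (simp add: d_def)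
  have nonzero: "carrier (add_monoid (Zp p)) - {\<one>\<^bsub>add_monoid (Zp p)\<^esub>} = {0..<int p} - {0}"
    by (auto simp: R.res_carrier_eq R.res_zero_eq)
  have "paley_matrix p $$ (i, j) =
      (\<Sum>g\<in>?S. if int i = g \<otimes>\<^bsub>add_monoid (Zp p)\<^esub> int j then 1 else 0) -
      (\<Sum>g\<in>(carrier (add_monoid (Zp p)) - {\<one>\<^bsub>add_monoid (Zp p)\<^esub>}) - ?S.
        if int i = g \<otimes>\<^bsub>add_monoid (Zp p)\<^esub> int j then 1 else 0)"
    unfolding paley_matrix_def
    by (rule index_group_signature) (use ij ord in \<open>auto simp: R.res_carrier_eq\<close>)
  also have "\<dots> = (if d \<in> ?S then 1 else 0) - (if d \<in> {0..<int p} - {0} - ?S then 1 else 0)"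
    unfolding nonzero by (intro arg_cong2[of _ _ _ _ minus] count) auto
  also have "\<dots> = of_int (Legendre d (int p))"
    using d zdvd_not_zless[of d "int p"] by (auto simp: Legendre_def cong_0_iff)
  also have "Legendre d (int p) = Legendre (int i - int j) (int p)"
    unfolding d_def by (rule legendre_mod)
  finally show ?thesis .
qed

definition paley_conference_matrix :: "nat \<Rightarrow> complex mat" where
  "paley_conference_matrix p = bordered_mat p (paley_matrix p)"

lemma paley_matrix_carrier:
  assumes "prime p"
  shows "paley_matrix p \<in> carrier_mat p p"
proof -
  interpret R: residues_prime p "Zp p"
    by unfold_locales (use assms in simp_all)
  have "Coset.order (add_monoid (Zp p)) = p"
    by (simp add: Coset.order_def R.res_carrier_eq)
  then show ?thesis
    unfolding paley_matrix_def using group_signature_carrier[of "add_monoid (Zp p)"] by metis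
qed

lemma paley_conference_carrier:
  "prime p \<Longrightarrow> paley_conference_matrix p \<in> carrier_mat (p + 1) (p + 1)"
  unfolding paley_conference_matrix_def by (intro bordered_mat_carrier paley_matrix_carrier)

lemma paley_conference_entry:
  assumes p: "prime p"
  shows "paley_conference_matrix p $$ (0, 0) = 0"
    and "i < p \<Longrightarrow> paley_conference_matrix p $$ (Suc i, 0) = 1"
    and "j < p \<Longrightarrow> paley_conference_matrix p $$ (0, Suc j) = 1"
    and "i < p \<Longrightarrow> j < p \<Longrightarrow> paley_conference_matrix p $$ (Suc i, Suc j) =
      of_int (Legendre (int i - int j) (int p))"
  unfolding paley_conference_matrix_def
  by (simp_all add: index_bordered_mat[OF paley_matrix_carrier[OF p]] paley_matrix_entry[OF p])

text \<open>
  Because the choice of enumeration is immaterial, index \<open>i\<close> may stand for the residue \<open>i\<close>, which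
  makes the matrix entries explicit.
\<close>

lemma quasi_signature_residues_iff:
  assumes p: "prime p"
  shows "quasi_signature_set (add_monoid (Zp p)) (p + 1) k {x \<in> {0..<int p}. Legendre x (int p) = 1} \<longleftrightarrow>
    is_signature_matrix (p + 1) k (paley_conference_matrix p)"
proof -
  interpret R: residues_prime p "Zp p"
    by unfold_locales (use p in simp_all)
  have ord: "Coset.order (add_monoid (Zp p)) = p"
    by (simp add: Coset.order_def R.res_carrier_eq)
  have carr: "carrier (add_monoid (Zp p)) = {0..<int p}"
    by (auto simp: R.res_carrier_eq)
  have one: "\<one>\<^bsub>add_monoid (Zp p)\<^esub> = 0"
    by (simp add: R.res_zero_eq)
  have "bij_betw int {..<p} {0..<int p}"
    by (rule bij_betw_byWitness[of _ nat]) auto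
  then have "group_enum (add_monoid (Zp p)) int"
    unfolding group_enum_def ord carr .
  moreover have "{x \<in> {0..<int p}. Legendre x (int p) = 1} \<subseteq> {0..<int p} - {0}"
    by (auto simp: legendre_of_dvd)
  moreover have "group (add_monoid (Zp p))"
    by (rule R.add.is_group)
  ultimately show ?thesis
    using quasi_signature_set_iff[of "add_monoid (Zp p)" _ int k]
    unfolding ord carr one paley_conference_matrix_def paley_matrix_def by simp
qed

text \<open>
  Self-adjointness at the two residues 0 and 1 compares \<open>\<chi>(- 1)\<close> with \<open>\<chi>(1) = 1\<close> and so forces
  \<open>p \<equiv> 1 (mod 4)\<close>. The dimension is read off from the entry of the squared matrix in the border
  row and the column of the residue 0. It is the sum of \<open>\<chi>\<close>, hence 0, while the entry of the matrix
  itself is 1, so the factor \<open>1 - 2k/n\<close> is 0.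
\<close>

lemma paley_frame_dimension:
  assumes p: "prime p" "2 < p" and u: "Legendre u (int p) = - 1"
    and sig: "is_signature_matrix (p + 1) k (paley_conference_matrix p)"
  shows "p mod 4 = 1" and "real k = (real p + 1) / 2"
proof -
  let ?Q = "paley_conference_matrix p"
  have adj: "mat_adjoint ?Q = ?Q"
    using sig by (simp add: is_signature_matrix_def)
  have "\<forall>i<p + 1. \<forall>j<p + 1. ?Q $$ (i, j) = cnj (?Q $$ (j, i))"
    using adj mat_adjoint_eq_iff[OF paley_conference_carrier[OF p(1)]] by blast
  then have "?Q $$ (Suc 0, Suc 1) = cnj (?Q $$ (Suc 1, Suc 0))"
    by (elim allE[of _ "Suc 0"] allE[of _ "Suc 1"] impE) (use p in simp_all)
  then have "Legendre (- 1) (int p) = Legendre 1 (int p)"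
    using p by (simp add: paley_conference_entry)
  also have "\<dots> = 1"
    using p by (simp add: legendre_one)
  finally have "even ((p - 1) div 2)"
    by (simp add: legendre_minus_one[OF p] minus_one_power_iff split: if_splits)
  moreover have "odd p"
    using p by (simp add: prime_odd_nat)
  ultimately show "p mod 4 = 1"
    using p by presburger
  have "(\<Sum>l<p + 1. ?Q $$ (0, l) * ?Q $$ (l, Suc 0)) = (\<Sum>l<p. of_int (Legendre (int l) (int p)))"
    using p by (simp add: sum.lessThan_Suc_shift paley_conference_entry del: sum.lessThan_Suc)
  also have "\<dots> = of_int (\<Sum>x\<in>{0..<int p}. Legendre x (int p))"
    by (simp add: sum_int_lessThan[of "\<lambda>x. of_int (Legendre x (int p))"])
  also have "\<dots> = 0"
    by (simp add: sum_legendre[OF p u])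
  finally have "complex_of_real (1 - 2 * real k / real (p + 1)) * ?Q $$ (0, Suc 0) = 0"
    using signature_matrix_square(2)[OF sig, of 0 "Suc 0"] p by simp
  then have "complex_of_real (1 - 2 * real k / real (p + 1)) = 0"
    using p by (simp add: paley_conference_entry del: of_real_eq_0_iff)
  then have "1 - 2 * real k / real (p + 1) = 0"
    by (simp only: of_real_eq_0_iff)
  then show "real k = (real p + 1) / 2"
    by (simp add: field_simps)
qed

text \<open>
  For \<open>p \<equiv> 1 (mod 4)\<close> the symbol \<open>\<chi>\<close> is even, so the matrix is symmetric. Two rows of the Paley
  matrix have inner product \<open>- 1\<close> by the autocorrelation, and the border contributes \<open>+ 1\<close>.
  The inner product of the border with any other row is the sum of \<open>\<chi>\<close>, which is 0.
\<close>

lemma paley_signature_matrix: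
  assumes p: "prime p" "p mod 4 = 1" and u: "Legendre u (int p) = - 1"
  shows "is_signature_matrix (p + 1) ((p + 1) div 2) (paley_conference_matrix p)"
proof -
  let ?Q = "paley_conference_matrix p"
  have p2: "2 < p"
    using p prime_ge_2_nat[of p] by (cases "p = 2") auto
  define L where "L x = Legendre x (int p)" for x
  have "even ((p - 1) div 2)"
    using p(2) by presburger
  then have "L (- 1) = 1"
    by (simp add: L_def legendre_minus_one[OF p(1) p2])
  then have even_L: "L (- x) = L x" for x
    using legendre_mult[OF p(1) p2, of "- 1" x] by (simp add: L_def)
  have per: "L (x mod int p) = L x" for x
    by (simp add: L_def legendre_mod)
  have per': "L (x mod int p + c) = L (x + c)" for x c
    by (metis per mod_add_left_eq)
  note entry = paley_conference_entry[OF p(1), folded L_def]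
  have row_sum: "(\<Sum>l<p. complex_of_int (L (int l + c))) = 0" for c
  proof -
    have "(\<Sum>l<p. L (int l + c)) = (\<Sum>x\<in>{0..<int p}. L x)"
      using p2 sum_residues_shift[of "int p" L c, OF _ per] sum_int_lessThan[of "\<lambda>x. L (x + c)"]
      by simp
    then show ?thesis
      using sum_legendre[OF p(1) p2 u] by (simp add: L_def flip: of_int_sum)
  qed
  have diff_nz: "\<not> int p dvd int i - int j" if "i < p" "j < p" "i \<noteq> j" for i j
  proof
    assume "int p dvd int i - int j"
    then have "int i mod int p = int j mod int p"
      by (simp add: mod_eq_dvd_iff)
    then show False using that by simp
  qed
  have row_product: "(\<Sum>l<p. complex_of_int (L (int i - int l) * L (int l - int j))) = - 1"
    if "i < p" "j < p" "i \<noteq> j" for i j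
  proof -
    \<comment> \<open>Evenness turns the convolution into an autocorrelation.\<close>
    have "(\<Sum>l<p. L (int i - int l) * L (int l - int j)) =
        (\<Sum>l<p. L (int l + (- int i)) * L (int l + (- int i) + (int i - int j)))"
      using even_L[of "int i - int l" for l] by (intro sum.cong refl) (simp add: algebra_simps)
    also have "\<dots> = (\<Sum>x\<in>{0..<int p}. L (x + (- int i)) * L (x + (- int i) + (int i - int j)))"
      by (rule sum_int_lessThan)
    also have "\<dots> = (\<Sum>x\<in>{0..<int p}. L x * L (x + (int i - int j)))"
      using p2 by (intro sum_residues_shift[where f = "\<lambda>x. L x * L (x + (int i - int j))"])
        (simp_all add: per per')
    also have "\<dots> = - 1"
      unfolding L_def by (rule legendre_autocorrelation[OF p(1) p2 u diff_nz[OF that]])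
    finally show ?thesis
      by (simp only: flip: of_int_sum) simp
  qed
  have Q: "?Q \<in> carrier_mat (p + 1) (p + 1)"
    by (rule paley_conference_carrier[OF p(1)])
  show ?thesis
  proof (rule signature_matrix_if_conference[OF Q])
    show "mat_adjoint ?Q = ?Q"
      unfolding mat_adjoint_eq_iff[OF Q]
    proof (intro allI impI)
      fix i j assume "i < p + 1" "j < p + 1"
      then show "?Q $$ (i, j) = cnj (?Q $$ (j, i))"
        using even_L[of "int (i - 1) - int (j - 1)"] by (cases i; cases j) (simp_all add: entry)
    qed
    show "?Q $$ (i, i) = 0" if "i < p + 1" for i
      using that by (cases i) (simp_all add: entry L_def legendre_of_dvd)
    show "cmod (?Q $$ (i, j)) = 1" if "i < p + 1" "j < p + 1" "i \<noteq> j" for i j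
    proof (cases "i = 0 \<or> j = 0")
      case True
      then show ?thesis using that by (cases i; cases j) (simp_all add: entry)
    next
      case False
      then obtain a b where ab: "i = Suc a" "j = Suc b"
        by (metis not0_implies_Suc)
      then have "L (int a - int b) = 1 \<or> L (int a - int b) = - 1"
        using diff_nz[of a b] that by (auto simp: L_def Legendre_def cong_0_iff)
      then show ?thesis using that by (auto simp: ab entry)
    qed
    show "(\<Sum>l<p + 1. ?Q $$ (i, l) * ?Q $$ (l, j)) = 0" if "i < p + 1" "j < p + 1" "i \<noteq> j" for i j
    proof -
      have split: "(\<Sum>l<p + 1. ?Q $$ (i, l) * ?Q $$ (l, j)) =
          ?Q $$ (i, 0) * ?Q $$ (0, j) + (\<Sum>l<p. ?Q $$ (i, Suc l) * ?Q $$ (Suc l, j))"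
        by (simp add: sum.lessThan_Suc_shift del: sum.lessThan_Suc)
      consider b where "i = 0" "j = Suc b" | a where "i = Suc a" "j = 0"
        | a b where "i = Suc a" "j = Suc b"
        using \<open>i \<noteq> j\<close> by (cases i; cases j) auto
      then show ?thesis
      proof cases
        case 1
        then have "(\<Sum>l<p. ?Q $$ (i, Suc l) * ?Q $$ (Suc l, j)) =
            (\<Sum>l<p. complex_of_int (L (int l + (- int b))))"
          using that by (intro sum.cong refl) (simp add: entry)
        then show ?thesis
          unfolding split row_sum using 1 by (simp add: entry)
      next
        case 2
        have "L (int a - int l) = L (int l + (- int a))" for l
          using even_L[of "int a - int l"] by simp
        with 2 have "(\<Sum>l<p. ?Q $$ (i, Suc l) * ?Q $$ (Suc l, j)) =
            (\<Sum>l<p. complex_of_int (L (int l + (- int a))))"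
          using that by (intro sum.cong refl) (simp add: entry)
        then show ?thesis
          unfolding split row_sum using 2 by (simp add: entry)
      next
        case 3
        then have "(\<Sum>l<p. ?Q $$ (i, Suc l) * ?Q $$ (Suc l, j)) =
            (\<Sum>l<p. complex_of_int (L (int a - int l) * L (int l - int b)))"
          using that by (intro sum.cong refl) (simp add: entry)
        also have "\<dots> = - 1"
          using row_product[of a b] that 3 by simp
        finally show ?thesis
          unfolding split using 3 that by (simp add: entry)
      qed
    qed
    show "p + 1 = 2 * ((p + 1) div 2)"
      using p(2) by presburger
    show "1 \<le> (p + 1) div 2"
      using p2 by simp
  qed
qed

theorem theorem5p12:
  fixes p :: nat
  assumes "prime p"
    and "generate (mult_of (Zp p)) {two_mod p} = carrier (mult_of (Zp p))"
  shows "((\<exists>k. quasi_signature_set (add_monoid (Zp p)) (p + 1) k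
                 (generate (mult_of (Zp p)) {two_mod p [^]\<^bsub>mult_of (Zp p)\<^esub> (2::nat)}))
            \<longleftrightarrow> [p = 5] (mod 8)) \<and>
         (\<forall>k. quasi_signature_set (add_monoid (Zp p)) (p + 1) k
                (generate (mult_of (Zp p)) {two_mod p [^]\<^bsub>mult_of (Zp p)\<^esub> (2::nat)})
            \<longrightarrow> real k = (real p + 1) / 2)"
proof -
  note S = quadratic_residues_generated[OF assms]
  note p = \<open>prime p\<close>
  have "p mod 8 \<noteq> 1"
  proof
    assume "p mod 8 = 1"
    then have "QuadRes (int p) 2"
      by (rule quadres_two_if_mod_8[OF p])
    then show False
      using S(2) by (simp add: Legendre_def split: if_splits)
  qed
  then have mod: "p mod 4 = 1 \<longleftrightarrow> [p = 5] (mod 8)"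
    unfolding cong_def by presburger
  show ?thesis
    unfolding S(3) quasi_signature_residues_iff[OF p]
    using paley_frame_dimension[OF p S(1,2)] paley_signature_matrix[OF p _ S(2)] mod by blast
qed

end
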